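(* Let $n\in\mathbb N$, let $\varphi:T_\Omega\to T_\Omega$ be holomorphic and $\psi\in H(T_\Omega)$, and suppose that $W_{\psi,\varphi}$ is a bounded weighted composition operator on $H^n_{2,\rho}(T_\Omega)$. Then for every $w\in T_\Omega$, $$W_{\psi,\varphi}^*K_w^{(n,\rho)}=\overline{\psi(w)}\,K_{\varphi(w)}^{(n,\rho)}.$$
   Context: Let $d\ge 1$ and let $\Omega\subset\mathbb R^d$ be a nonempty open convex cone containing no complete straight line. Its dual cone is $\Omega^\ast=\{\xi\in\mathbb R^d:\langle x,\xi\rangle\ge 0\text{ for all }x\in\Omega\}$, and $T_\Omega=\mathbb R^d+i\Omega\subset\mathbb C^d$ is the associated tube domain; $H(T_\Omega)$ is the space of holomorphic functions on $T_\Omega$. For $z\in\mathbb C^d$, $\xi\in\mathbb R^d$, $\langle z,\xi\rangle=\sum_{j=1}^d z_j\xi_j$ (bilinear). Fix a continuous function $\rho:\Omega^\ast\to[0,\infty)$ with $\rho(\xi)>0$ for $\xi\ne 0$ and $\rho(t\xi)=t\rho(\xi)$ for all $t>0$, $\xi\in\Omega^\ast$ (so $\rho(0)=0$). For $n\in\mathbb N$ let $w_n(\xi)=\sum_{k=0}^n\rho(\xi)^{2k}$, and let $L^2(\Omega^\ast,w_n)$ be the space of (classes of) measurable complex functions $f$ on $\Omega^\ast$ with $\|f\|_{L^2(\Omega^\ast,w_n)}^2=\int_{\Omega^\ast}|f|^2w_n\,d\xi<\infty$. The Hilbertian Hardy--Sobolev space $H^n_{2,\rho}(T_\Omega)$ consists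 of all holomorphic functions on $T_\Omega$ of the form $\mathcal Lf(z)=\int_{\Omega^\ast}e^{i\langle z,\xi\rangle}f(\xi)\,d\xi$ with $f\in L^2(\Omega^\ast,w_n)$. The map $\mathcal L$ is injective on $L^2(\Omega^\ast,w_n)$, and $H^n_{2,\rho}(T_\Omega)$ is a Hilbert space with inner product $\langle\mathcal Lf,\mathcal Lg\rangle=\int_{\Omega^\ast}f\overline g\,w_n\,d\xi$. Point evaluations at points of $T_\Omega$ are bounded on it. For $w\in T_\Omega$, $K^{(n,\rho)}_w\in H^n_{2,\rho}(T_\Omega)$ denotes the unique function with $F(w)=\langle F,K^{(n,\rho)}_w\rangle$ for all $F\in H^n_{2,\rho}(T_\Omega)$. The weighted composition operator is $W_{\psi,\varphi}F=\psi\cdot(F\circ\varphi)$. It is a bounded weighted composition operator on $H^n_{2,\rho}(T_\Omega)$ if $W_{\psi,\varphi}F\in H^n_{2,\rho}(T_\Omega)$ for all $F\in H^n_{2,\rho}(T_\Omega)$ and the resulting linear operator is bounded; $W_{\psi,\varphi}^*$ is its Hilbert space adjoint. *)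

theory Defs
  imports "HOL-Analysis.Analysis"
begin

text \<open>
  A function on the tube domain is represented by a total function on \<open>complex ^ 'd\<close>
  that vanishes off the tube. Equality of such functions is then equality on the tube, and sums and
  scalar multiples are the pointwise ones.
\<close>

definition dual_cone :: "(real ^ 'd) set \<Rightarrow> (real ^ 'd) set" where
  "dual_cone \<Omega> = {\<xi>. \<forall>x\<in>\<Omega>. 0 \<le> x \<bullet> \<xi>}"

definition tube :: "(real ^ 'd) set \<Rightarrow> (complex ^ 'd) set" where
  "tube \<Omega> = {z. (\<chi> j. Im (z $ j)) \<in> \<Omega>}"

text \<open>Holomorphy in several variables: Frechet differentiability with complex-linear derivative.\<close>

definition holomorphic_vec_on :: "(complex ^ 'd \<Rightarrow> complex) \<Rightarrow> (complex ^ 'd) set \<Rightarrow> bool" where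
  "holomorphic_vec_on F U \<longleftrightarrow>
     (\<forall>z\<in>U. \<exists>D. (F has_derivative D) (at z within U) \<and> (\<forall>c v. D (c *s v) = c * D v))"

definition bilin :: "complex ^ 'd \<Rightarrow> real ^ 'd \<Rightarrow> complex" where
  "bilin z \<xi> = (\<Sum>j\<in>UNIV. z $ j * complex_of_real (\<xi> $ j))"

definition weight :: "(real ^ 'd \<Rightarrow> real) \<Rightarrow> nat \<Rightarrow> real ^ 'd \<Rightarrow> real" where
  "weight \<rho> n \<xi> = (\<Sum>k=0..n. \<rho> \<xi> ^ (2 * k))"

text \<open>Actual functions rather than classes modulo null sets.\<close>

definition weighted_L2 ::
    "(real ^ 'd) set \<Rightarrow> (real ^ 'd \<Rightarrow> real) \<Rightarrow> nat \<Rightarrow> (real ^ 'd \<Rightarrow> complex) set" where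
  "weighted_L2 \<Omega> \<rho> n =
     {f. f \<in> borel_measurable (lebesgue_on (dual_cone \<Omega>)) \<and>
         integrable (lebesgue_on (dual_cone \<Omega>)) (\<lambda>\<xi>. (cmod (f \<xi>))\<^sup>2 * weight \<rho> n \<xi>)}"

definition laplace :: "(real ^ 'd) set \<Rightarrow> (real ^ 'd \<Rightarrow> complex) \<Rightarrow> complex ^ 'd \<Rightarrow> complex" where
  "laplace \<Omega> f z =
     (if z \<in> tube \<Omega>
      then LINT \<xi>|lebesgue_on (dual_cone \<Omega>). exp (\<i> * bilin z \<xi>) * f \<xi>
      else 0)"

definition hardy_sobolev ::
    "(real ^ 'd) set \<Rightarrow> (real ^ 'd \<Rightarrow> real) \<Rightarrow> nat \<Rightarrow> (complex ^ 'd \<Rightarrow> complex) set" where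
  "hardy_sobolev \<Omega> \<rho> n =
     {F. holomorphic_vec_on F (tube \<Omega>) \<and> (\<exists>f\<in>weighted_L2 \<Omega> \<rho> n. F = laplace \<Omega> f)}"

text \<open>The value does not depend on the choice of \<open>f\<close> and \<open>g\<close>, since the transform is injective up to
  null sets; it is meaningful only for \<open>F\<close> and \<open>G\<close> in the space.\<close>

definition hs_inner ::
    "(real ^ 'd) set \<Rightarrow> (real ^ 'd \<Rightarrow> real) \<Rightarrow> nat \<Rightarrow>
     (complex ^ 'd \<Rightarrow> complex) \<Rightarrow> (complex ^ 'd \<Rightarrow> complex) \<Rightarrow> complex" where
  "hs_inner \<Omega> \<rho> n F G =
     (THE c. \<exists>f\<in>weighted_L2 \<Omega> \<rho> n. \<exists>g\<in>weighted_L2 \<Omega> \<rho> n. F = laplace \<Omega> f \<and> G = laplace \<Omega> g \<and>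
        c = (LINT \<xi>|lebesgue_on (dual_cone \<Omega>). f \<xi> * cnj (g \<xi>) * complex_of_real (weight \<rho> n \<xi>)))"

definition hs_norm ::
    "(real ^ 'd) set \<Rightarrow> (real ^ 'd \<Rightarrow> real) \<Rightarrow> nat \<Rightarrow> (complex ^ 'd \<Rightarrow> complex) \<Rightarrow> real" where
  "hs_norm \<Omega> \<rho> n F = sqrt (Re (hs_inner \<Omega> \<rho> n F F))"

definition repr_kernel ::
    "(real ^ 'd) set \<Rightarrow> (real ^ 'd \<Rightarrow> real) \<Rightarrow> nat \<Rightarrow> complex ^ 'd \<Rightarrow> complex ^ 'd \<Rightarrow> complex" where
  "repr_kernel \<Omega> \<rho> n w =
     (THE K. K \<in> hardy_sobolev \<Omega> \<rho> n \<and>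
        (\<forall>F\<in>hardy_sobolev \<Omega> \<rho> n. F w = hs_inner \<Omega> \<rho> n F K))"

definition weighted_comp ::
    "(real ^ 'd) set \<Rightarrow> (complex ^ 'd \<Rightarrow> complex) \<Rightarrow> (complex ^ 'd \<Rightarrow> complex ^ 'd) \<Rightarrow>
     (complex ^ 'd \<Rightarrow> complex) \<Rightarrow> (complex ^ 'd \<Rightarrow> complex)" where
  "weighted_comp \<Omega> \<psi> \<phi> F = (\<lambda>z. if z \<in> tube \<Omega> then \<psi> z * F (\<phi> z) else 0)"

text \<open>Linearity is not required separately: weighted composition is linear in \<open>F\<close>.\<close>

definition bounded_weighted_comp ::
    "(real ^ 'd) set \<Rightarrow> (real ^ 'd \<Rightarrow> real) \<Rightarrow> nat \<Rightarrow>
     (complex ^ 'd \<Rightarrow> complex) \<Rightarrow> (complex ^ 'd \<Rightarrow> complex ^ 'd) \<Rightarrow> bool" where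
  "bounded_weighted_comp \<Omega> \<rho> n \<psi> \<phi> \<longleftrightarrow>
     (\<forall>F\<in>hardy_sobolev \<Omega> \<rho> n. weighted_comp \<Omega> \<psi> \<phi> F \<in> hardy_sobolev \<Omega> \<rho> n) \<and>
     (\<exists>C. \<forall>F\<in>hardy_sobolev \<Omega> \<rho> n.
        hs_norm \<Omega> \<rho> n (weighted_comp \<Omega> \<psi> \<phi> F) \<le> C * hs_norm \<Omega> \<rho> n F)"

text \<open>The Hilbert space adjoint of a bounded operator \<open>A\<close> on the Hardy--Sobolev space. The library's
  \<open>adjoint\<close> is for real inner product types and does not apply.\<close>

definition hs_adjoint ::
    "(real ^ 'd) set \<Rightarrow> (real ^ 'd \<Rightarrow> real) \<Rightarrow> nat \<Rightarrow>
     ((complex ^ 'd \<Rightarrow> complex) \<Rightarrow> (complex ^ 'd \<Rightarrow> complex)) \<Rightarrow>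
     (complex ^ 'd \<Rightarrow> complex) \<Rightarrow> (complex ^ 'd \<Rightarrow> complex)" where
  "hs_adjoint \<Omega> \<rho> n A G =
     (THE G'. G' \<in> hardy_sobolev \<Omega> \<rho> n \<and>
        (\<forall>F\<in>hardy_sobolev \<Omega> \<rho> n. hs_inner \<Omega> \<rho> n (A F) G = hs_inner \<Omega> \<rho> n F G'))"

end

theory Submission
  imports Defs
begin

text \<open>
  The identity itself is formal. For \<open>F\<close> in the space, \<open>W F\<close> is again in the space, and the
  reproducing property, used at \<open>w\<close> and then at \<open>\<phi> w\<close>, gives
  \<open>\<langle>W F, K\<^sub>w\<rangle> = (W F) w = \<psi> w * F (\<phi> w) = \<psi> w * \<langle>F, K\<^bsub>\<phi> w\<^esub>\<rangle> = \<langle>F, cnj (\<psi> w) * K\<^bsub>\<phi> w\<^esub>\<rangle>\<close>.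
  The adjoint applied to \<open>K\<^sub>w\<close> is the only element of the space with this property.

  The work lies in the facts about the space that this computation presupposes, namely that the
  inner product is well defined and that the kernels exist and separate functions.

  The inner product is defined through densities, so it is well defined once the Laplace transform
  is injective up to null sets (\<open>laplace_inject\<close>). Restricted to imaginary points of the tube the
  transform is a real Laplace transform, whose exponentials generate an algebra of functions on the
  dual cone; polynomial approximation shows that a function orthogonal to all of them has vanishing
  integral over every orthant, and hence vanishes almost everywhere
  (\<open>AE_eq_0_if_real_laplace_eq_0\<close>).

  The kernel at \<open>w\<close> is given explicitly as the transform of \<open>kernel_density w\<close>. That density is square
  integrable against the weight because \<open>y \<bullet> \<xi> \<ge> c |\<xi>|\<close> on the dual cone for \<open>y \<in> \<Omega>\<close>
  (\<open>dual_cone_coercive\<close>). Its transform belongs to the space only if it is holomorphic on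
  the tube (\<open>holomorphic_laplace\<close>). Both the kernel and the adjoint are described by uniqueness,
  which follows by testing against the kernels themselves (\<open>hardy_sobolev_eqI\<close>).
\<close>

section \<open>Functions determined by their integrals over orthants\<close>

lemma sigma_finite_completion:
  assumes "sigma_finite_measure M"
  shows "sigma_finite_measure (completion M)"
proof -
  obtain C where "countable C" "C \<subseteq> sets M" "\<Union>C = space M" "\<forall>a\<in>C. emeasure M a \<noteq> \<infinity>"
    using sigma_finite_measure.sigma_finite_countable[OF assms] by auto
  then show ?thesis
    by (intro sigma_finite_measure.intro exI[of _ C]) (auto simp: subset_iff)
qed

text \<open>
  The orthants \<open>{..a}\<close> form an intersection-stable generator of the Borel sets, so by Dynkin's
  argument the integral of \<open>g\<close> vanishes on every Borel set; since \<open>UNIV\<close> is not an orthant, the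
  hypothesis on the total integral is what gives closure under complements. Lebesgue sets differ
  from Borel sets only by null sets.
\<close>

lemma AE_eq_0_if_integral_atMost_eq_0:
  fixes g :: "'a::ordered_euclidean_space \<Rightarrow> 'b::{second_countable_topology, banach}"
  assumes S: "S \<in> sets lebesgue"
    and g: "integrable (lebesgue_on S) g"
    and total: "(LINT x|lebesgue_on S. g x) = 0"
    and orthant: "\<And>a. (LINT x|lebesgue_on S. indicator {..a} x *\<^sub>R g x) = 0"
  shows "AE x in lebesgue_on S. g x = 0"
proof -
  let ?M = "lebesgue_on S"
  have meas: "A \<inter> S \<in> sets ?M" if "A \<in> sets borel" for A :: "'a set"
    using that by (auto simp: sets_restrict_space)
  have ind[measurable]: "(indicator A :: 'a \<Rightarrow> real) \<in> borel_measurable ?M"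
    if "A \<in> sets borel" for A :: "'a set"
    using that by (intro measurable_restrict_space1 borel_measurable_indicator) auto
  have int: "integrable ?M (\<lambda>x. indicator A x *\<^sub>R g x)" if "A \<in> sets borel" for A :: "'a set"
    using that by (intro Bochner_Integration.integrable_bound[OF g] borel_measurable_scaleR ind 
        borel_measurable_integrable[OF g]) (auto simp: indicator_def)
  have borel0: "(LINT x|?M. indicator A x *\<^sub>R g x) = 0" if "A \<in> sets borel" for A :: "'a set"
  proof -
    have gen: "sets borel = sigma_sets UNIV (range (\<lambda>a::'a. {..a}))"
      by (subst borel_eq_atMost) simp
    have *: "B \<in> sets borel" if "B \<in> sigma_sets UNIV (range (\<lambda>a::'a. {..a}))" for B
      using that gen by simp
    have "Int_stable (range (\<lambda>a::'a. {..a}))"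
    proof (rule Int_stableI)
      fix A B :: "'a set" assume "A \<in> range (\<lambda>a. {..a})" "B \<in> range (\<lambda>a. {..a})"
      then obtain a b where "A = {..a}" "B = {..b}" by blast
      then have "A \<inter> B = {..inf a b}" by auto
      then show "A \<inter> B \<in> range (\<lambda>a. {..a})" by blast
    qed
    moreover have "range (\<lambda>a::'a. {..a}) \<subseteq> Pow UNIV" by simp
    ultimately show ?thesis
      using that[unfolded gen]
    proof (induction rule: sigma_sets_induct_disjoint)
      case (basic A)
      then show ?case using orthant by auto
    next
      case empty
      show ?case by simp
    next
      case (compl A)
      have "(LINT x|?M. indicator (UNIV - A) x *\<^sub>R g x) = (LINT x|?M. g x - indicator A x *\<^sub>R g x)"
        by (intro Bochner_Integration.integral_cong) (auto simp: indicator_def)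
      also have "\<dots> = 0"
        using compl total int[OF *] g by (simp add: Bochner_Integration.integral_diff)
      finally show ?case .
    next
      case (union A)
      have b: "A i \<in> sets borel" for i using union(2) * by auto
      let ?A = "\<lambda>i. A i \<inter> S"
      have "(LINT x:(\<Union>i. ?A i)|?M. g x) = (\<Sum>i. (LINT x:?A i|?M. g x))"
      proof (rule lebesgue_integral_countable_add)
        show "?A i \<in> sets ?M" for i using meas[OF b] .
        show "?A i \<inter> ?A j = {}" if "i \<noteq> j" for i j
          using union(1) that by (auto simp: disjoint_family_on_def)
        show "set_integrable ?M (\<Union>i. ?A i) g"
          unfolding set_integrable_def
          using int[of "\<Union>i. A i"] b
          by (subst Bochner_Integration.integrable_cong[where g="\<lambda>x. indicator (\<Union>i. A i) x *\<^sub>R g x"])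
             (auto simp: indicator_def)
      qed
      moreover have "(LINT x:?A i|?M. g x) = 0" for i
        unfolding set_lebesgue_integral_def
        by (subst union(3)[of i, symmetric], intro Bochner_Integration.integral_cong)
           (auto simp: indicator_def)
      moreover have "(LINT x:(\<Union>i. ?A i)|?M. g x) = (LINT x|?M. indicator (\<Union>i. A i) x *\<^sub>R g x)"
        unfolding set_lebesgue_integral_def
        by (intro Bochner_Integration.integral_cong) (auto simp: indicator_def)
      ultimately show ?case by simp
    qed
  qed
  interpret sigma_finite_measure ?M
    using S by (intro sigma_finite_measure_restrict_space sigma_finite_completion
        sigma_finite_lborel) auto
  show ?thesis
  proof (rule density_zero[OF g])
    fix A assume A: "A \<in> sets ?M"
    then have "A \<in> sets lebesgue"
      using S sets_restrict_space_iff[of S lebesgue A] by auto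
    then obtain B N N' where N: "A = B \<union> N" "N \<subseteq> N'" "N' \<in> null_sets lborel" "B \<in> sets lborel"
      by (rule sets_completionE)
    have "AE x in lebesgue. x \<notin> N'"
      using AE_completion[OF AE_not_in[OF N(3)]] .
    then have "AE x in ?M. x \<notin> N'"
      using S by (subst AE_restrict_space_iff) auto
    then have "AE x in ?M. indicator A x *\<^sub>R g x = indicator B x *\<^sub>R g x"
      by eventually_elim (use N in \<open>auto simp: indicator_def\<close>)
    then have "(LINT x|?M. indicator A x *\<^sub>R g x) = (LINT x|?M. indicator B x *\<^sub>R g x)"
      using A N(4) borel_measurable_integrable[OF g]
      by (intro integral_cong_AE borel_measurable_scaleR ind borel_measurable_indicator) auto
    then show "set_lebesgue_integral ?M A g = 0"
      using borel0 N(4) by (simp add: set_lebesgue_integral_def)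
  qed
qed

section \<open>Exponential decay\<close>

lemma integrable_exp_minus_abs:
  fixes c :: real
  assumes "c > 0"
  shows "integrable lborel (\<lambda>t::real. exp (- c * \<bar>t\<bar>))"
proof -
  have "(\<integral>\<^sup>+x. ennreal (exp (- c * x)) * indicator {0 ..} x \<partial>lborel) = ennreal (0 - (- exp (- c * 0) / c))"
  proof (rule nn_integral_FTC_atLeast)
    have "filterlim (\<lambda>x. - c * x) at_bot at_top"
      using assms
      by (intro filterlim_tendsto_neg_mult_at_bot[OF tendsto_const _ filterlim_ident]) auto
    then have "((\<lambda>x. exp (- c * x)) \<longlongrightarrow> 0) at_top"
      by (rule filterlim_compose[OF exp_at_bot])
    then have "((\<lambda>x. - exp (- c * x) / c) \<longlongrightarrow> - 0 / c) at_top"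
      using assms by (intro tendsto_intros) auto
    then show "((\<lambda>x. - exp (- c * x) / c) \<longlongrightarrow> 0) at_top" by simp
  qed (use assms in \<open>auto intro!: derivative_eq_intros\<close>)
  also have "(\<integral>\<^sup>+x. ennreal (exp (- c * x)) * indicator {0 ..} x \<partial>lborel)
      = (\<integral>\<^sup>+x. norm (indicator {0..} x * exp (- c * x)) \<partial>lborel)"
    by (intro nn_integral_cong) (auto simp: indicator_def)
  finally have r: "integrable lborel (\<lambda>x. indicator {0..} x * exp (- c * x))"
    by (intro integrableI_bounded) auto
  from lborel_integrable_real_affine[OF this, of "-1" 0]
  have l: "integrable lborel (\<lambda>x. indicator {0..} (-x) * exp (c * x))" by simp
  from Bochner_Integration.integrable_add[OF r l] show ?thesis
    by (rule Bochner_Integration.integrable_bound) (auto simp: indicator_def abs_real_def)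
qed

text \<open>
  Each coordinate is at most the norm in absolute value, so the average of their absolute values is
  too. Hence the integrand is dominated by a product of functions of one variable, to which Tonelli
  applies.
\<close>

lemma integrable_exp_minus_norm:
  fixes c :: real
  assumes "c > 0"
  shows "integrable lborel (\<lambda>x::'a::euclidean_space. exp (- c * norm x))"
proof (rule integrableI_bounded)
  define c' where "c' = c / DIM('a)"
  have c: "c' > 0" using assms by (simp add: c'_def)
  have le: "norm (exp (- c * norm x)) \<le> (\<Prod>b\<in>Basis. exp (- c' * \<bar>x \<bullet> b\<bar>))" for x :: 'a
  proof -
    have "(\<Sum>b\<in>Basis. \<bar>x \<bullet> b\<bar>) \<le> (\<Sum>b\<in>(Basis::'a set). norm x)"
      by (intro sum_mono Basis_le_norm)
    then have "c' * (\<Sum>b\<in>Basis. \<bar>x \<bullet> b\<bar>) \<le> c' * (DIM('a) * norm x)"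
      using c by (intro mult_left_mono) auto
    then have "c' * (\<Sum>b\<in>Basis. \<bar>x \<bullet> b\<bar>) \<le> c * norm x" by (simp add: c'_def)
    moreover have "(\<Prod>b\<in>Basis. exp (- c' * \<bar>x \<bullet> b\<bar>)) = exp (- (c' * (\<Sum>b\<in>Basis. \<bar>x \<bullet> b\<bar>)))"
      by (simp add: exp_sum[symmetric] sum_negf sum_distrib_left)
    ultimately show ?thesis by simp
  qed
  have "(\<integral>\<^sup>+x. ennreal (norm (exp (- c * norm x))) \<partial>(lborel :: 'a measure))
      \<le> (\<integral>\<^sup>+x. (\<Prod>b\<in>Basis. ennreal (exp (- c' * \<bar>x \<bullet> b\<bar>))) \<partial>(lborel :: 'a measure))"
    using le by (intro nn_integral_mono) (simp add: prod_ennreal ennreal_leI del: real_norm_def mult_minus_left)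
  also have "\<dots> = (\<Prod>b\<in>(Basis::'a set). (\<integral>\<^sup>+t. ennreal (exp (- c' * \<bar>t\<bar>)) \<partial>lborel))"
    by (rule nn_integral_lborel_prod) auto
  also have "\<dots> < \<infinity>"
    using integrable_exp_minus_abs[OF c, unfolded integrable_iff_bounded]
    by (simp add: prod_constant power_less_top_ennreal)
  finally show "(\<integral>\<^sup>+x. ennreal (norm (exp (- c * norm x))) \<partial>(lborel :: 'a measure)) < \<infinity>" .
qed auto

section \<open>The weight and the pairing\<close>

text \<open>
  The summand for \<open>k = 0\<close> is \<open>1\<close> and the others are even powers. The bound makes the weighted
  space a subspace of the unweighted one.
\<close>

lemma one_le_weight: "1 \<le> weight \<rho> n \<xi>"
proof -
  have "(\<Sum>k\<in>{0}. \<rho> \<xi> ^ (2 * k)) \<le> (\<Sum>k=0..n. \<rho> \<xi> ^ (2 * k))"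
    by (rule sum_mono2) auto
  then show ?thesis by (simp add: weight_def)
qed

lemma bilin_add: "bilin (z + w) \<xi> = bilin z \<xi> + bilin w \<xi>"
  by (simp add: bilin_def algebra_simps sum.distrib)

lemma bilin_diff: "bilin (z - w) \<xi> = bilin z \<xi> - bilin w \<xi>"
  by (simp add: bilin_def algebra_simps sum_subtractf)

lemma bilin_scale: "bilin (c *s z) \<xi> = c * bilin z \<xi>"
  by (simp add: bilin_def sum_distrib_left mult.assoc)

lemma bilin_scaleR: "bilin (r *\<^sub>R z) \<xi> = r *\<^sub>R bilin z \<xi>"
  by (simp add: bilin_def scaleR_sum_right)

lemma norm_bilin_le: "norm (bilin z \<xi>) \<le> norm z * norm \<xi>"
proof -
  have "norm (bilin z \<xi>) \<le> (\<Sum>j\<in>UNIV. \<bar>norm (z $ j)\<bar> * \<bar>\<xi> $ j\<bar>)"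
    unfolding bilin_def by (rule order.trans[OF norm_sum]) (simp add: norm_mult)
  also have "\<dots> \<le> L2_set (\<lambda>j. norm (z $ j)) UNIV * L2_set (\<lambda>j. \<xi> $ j) UNIV"
    by (rule L2_set_mult_ineq)
  also have "\<dots> = norm z * norm \<xi>"
    by (simp add: norm_vec_def L2_set_def)
  finally show ?thesis .
qed

lemma norm_exp_bilin: "norm (exp (\<i> * bilin z \<xi>)) = exp (- ((\<chi> j. Im (z $ j)) \<bullet> \<xi>))"
  by (simp add: bilin_def inner_vec_def)

lemma exp_bilin_imaginary:
  "exp (\<i> * bilin (\<chi> j. \<i> * complex_of_real (y $ j)) \<xi>) = complex_of_real (exp (- (y \<bullet> \<xi>)))"
proof -
  have "\<i> * bilin (\<chi> j. \<i> * complex_of_real (y $ j)) \<xi> = complex_of_real (- (y \<bullet> \<xi>))"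
    by (simp add: bilin_def inner_vec_def sum_distrib_left mult.assoc[symmetric] sum_negf)
  then show ?thesis by (simp only: exp_of_real)
qed

lemma continuous_on_bilin [continuous_intros]: "continuous_on A (bilin z)"
  unfolding bilin_def by (intro continuous_intros)

lemma norm_exp_minus_affine_le:
  fixes z :: complex
  shows "norm (exp z - 1 - z) \<le> exp (norm z) * (norm z)\<^sup>2"
proof -
  have "norm (exp z - (1 + z)) \<le> exp \<bar>Re z\<bar> * (norm z)\<^sup>2"
    using Taylor_exp[of z 1] by (simp add: power2_eq_square)
  also have "\<dots> \<le> exp (norm z) * (norm z)\<^sup>2"
    by (intro mult_right_mono) (auto simp: abs_Re_le_cmod)
  finally show ?thesis by (simp add: algebra_simps)
qed

section \<open>Laplace transforms on the tube\<close>

text \<open>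
  For a convex cone, closure under addition is what matters below: it makes the set of real
  exponentials \<open>\<xi> \<mapsto> exp (- (y \<bullet> \<xi>))\<close> with \<open>y \<in> \<Omega>\<close> closed under multiplication.
\<close>

locale open_cone =
  fixes \<Omega> :: "(real ^ 'd::finite) set"
  assumes nonempty: "\<Omega> \<noteq> {}"
    and open_Omega: "open \<Omega>"
    and add_closed: "\<And>x y. x \<in> \<Omega> \<Longrightarrow> y \<in> \<Omega> \<Longrightarrow> x + y \<in> \<Omega>"
begin

abbreviation M :: "(real ^ 'd) measure" where
  "M \<equiv> lebesgue_on (dual_cone \<Omega>)"

lemma closed_dual_cone: "closed (dual_cone \<Omega>)"
proof -
  have "dual_cone \<Omega> = (\<Inter>x\<in>\<Omega>. {\<xi>. 0 \<le> x \<bullet> \<xi>})"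
    by (auto simp: dual_cone_def)
  then show ?thesis
    by (auto intro!: closed_INT closed_Collect_le continuous_intros)
qed

lemma dual_cone_lebesgue [simp]: "dual_cone \<Omega> \<in> sets lebesgue"
  using closed_dual_cone by (simp add: borel_closed)

lemma borel_measurable_continuous:
  "continuous_on (dual_cone \<Omega>) f \<Longrightarrow> f \<in> borel_measurable M"
  by (simp add: continuous_imp_measurable_on_sets_lebesgue)

text \<open>
  If the ball of radius \<open>r\<close> around \<open>y\<close> lies in \<open>\<Omega>\<close>, then so does \<open>y - r \<xi> / |\<xi>|\<close>, and pairing it with
  \<open>\<xi>\<close> gives a nonnegative number. This is where openness of \<open>\<Omega>\<close> turns nonnegativity on the dual
  cone into exponential decay.
\<close>

lemma dual_cone_coercive:
  assumes "y \<in> \<Omega>"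
  obtains c where "c > 0" "\<And>\<xi>. \<xi> \<in> dual_cone \<Omega> \<Longrightarrow> c * norm \<xi> \<le> y \<bullet> \<xi>"
proof -
  obtain r where r: "r > 0" "cball y r \<subseteq> \<Omega>"
    using open_Omega assms by (meson open_contains_cball)
  show ?thesis
  proof (rule that[OF r(1)])
    fix \<xi> assume \<xi>: "\<xi> \<in> dual_cone \<Omega>"
    have "y - r *\<^sub>R sgn \<xi> \<in> cball y r"
      using r(1) by (simp add: dist_norm norm_sgn)
    then have "y - r *\<^sub>R sgn \<xi> \<in> \<Omega>"
      using r(2) by blast
    then have "0 \<le> (y - r *\<^sub>R sgn \<xi>) \<bullet> \<xi>"
      using \<xi> by (auto simp: dual_cone_def)
    moreover have "sgn \<xi> \<bullet> \<xi> = norm \<xi>"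
      by (cases "\<xi> = 0") (auto simp: sgn_div_norm dot_square_norm power2_eq_square)
    ultimately show "r * norm \<xi> \<le> y \<bullet> \<xi>"
      by (simp add: inner_diff_left)
  qed
qed

lemma integrable_exp_minus_norm_dual_cone:
  fixes c :: real
  assumes "c > 0"
  shows "integrable M (\<lambda>\<xi>. exp (- c * norm \<xi>))"
proof -
  have "integrable lebesgue (\<lambda>\<xi>::real^'d. exp (- c * norm \<xi>))"
    using integrable_exp_minus_norm[OF assms] by (subst integrable_completion) auto
  then show ?thesis
    by (intro integrable_restrict_space[THEN iffD2] integrable_mult_indicator) auto
qed

text \<open>
  Pointwise \<open>2 a b \<le> a\<^sup>2 + b\<^sup>2\<close>, and the squares of both factors are integrable, the second one
  because the weight is at least \<open>1\<close>.
\<close>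

lemma weighted_L2_integrable_exp:
  fixes c :: real
  assumes f: "f \<in> weighted_L2 \<Omega> \<rho> n" and c: "c > 0"
  shows "integrable M (\<lambda>\<xi>. exp (- c * norm \<xi>) * norm (f \<xi>))"
proof -
  have f': "f \<in> borel_measurable M" "integrable M (\<lambda>\<xi>. (cmod (f \<xi>))\<^sup>2 * weight \<rho> n \<xi>)"
    using f by (auto simp: weighted_L2_def)
  have "integrable M (\<lambda>\<xi>. exp (- (2 * c) * norm \<xi>) + (cmod (f \<xi>))\<^sup>2 * weight \<rho> n \<xi>)"
    using c by (intro Bochner_Integration.integrable_add integrable_exp_minus_norm_dual_cone f') auto
  then show ?thesis
  proof (rule Bochner_Integration.integrable_bound)
    have "(\<lambda>\<xi>. exp (- c * norm \<xi>)) \<in> borel_measurable M"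
      by (intro borel_measurable_continuous continuous_intros)
    then show "(\<lambda>\<xi>. exp (- c * norm \<xi>) * norm (f \<xi>)) \<in> borel_measurable M"
      using f'(1) by simp
    have "exp (- c * norm \<xi>) * norm (f \<xi>)
        \<le> exp (- (2 * c) * norm \<xi>) + (cmod (f \<xi>))\<^sup>2 * weight \<rho> n \<xi>" for \<xi>
    proof -
      have "2 * (exp (- c * norm \<xi>) * norm (f \<xi>)) \<le> (exp (- c * norm \<xi>))\<^sup>2 + (norm (f \<xi>))\<^sup>2"
        using sum_squares_bound[of "exp (- c * norm \<xi>)" "norm (f \<xi>)"] by (simp add: mult.assoc)
      moreover have "(exp (- c * norm \<xi>))\<^sup>2 = exp (- (2 * c) * norm \<xi>)"
        by (simp add: exp_double[symmetric])
      moreover have "(norm (f \<xi>))\<^sup>2 * 1 \<le> (norm (f \<xi>))\<^sup>2 * weight \<rho> n \<xi>"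
        by (intro mult_left_mono one_le_weight) auto
      moreover have "0 \<le> exp (- c * norm \<xi>) * norm (f \<xi>)" by simp
      ultimately show ?thesis by linarith
    qed
    then show "AE \<xi> in M. norm (exp (- c * norm \<xi>) * norm (f \<xi>))
        \<le> norm (exp (- (2 * c) * norm \<xi>) + (cmod (f \<xi>))\<^sup>2 * weight \<rho> n \<xi>)"
      by (intro AE_I2) (simp add: abs_of_nonneg order.trans[OF _ abs_ge_self])
  qed
qed

lemma weighted_L2_integrable_mult:
  fixes h :: "real ^ 'd \<Rightarrow> complex"
  assumes f: "f \<in> weighted_L2 \<Omega> \<rho> n" and c: "c > 0"
    and h: "continuous_on (dual_cone \<Omega>) h"
    and le: "\<And>\<xi>. \<xi> \<in> dual_cone \<Omega> \<Longrightarrow> norm (h \<xi>) \<le> C * exp (- c * norm \<xi>)"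
  shows "integrable M (\<lambda>\<xi>. h \<xi> * f \<xi>)"
proof (rule Bochner_Integration.integrable_bound)
  show "integrable M (\<lambda>\<xi>. C * (exp (- c * norm \<xi>) * norm (f \<xi>)))"
    by (intro integrable_mult_right weighted_L2_integrable_exp[OF f c])
  show "(\<lambda>\<xi>. h \<xi> * f \<xi>) \<in> borel_measurable M"
    using borel_measurable_continuous[OF h] f by (auto simp: weighted_L2_def)
  show "AE \<xi> in M. norm (h \<xi> * f \<xi>) \<le> norm (C * (exp (- c * norm \<xi>) * norm (f \<xi>)))"
  proof (rule AE_I2)
    fix \<xi> assume "\<xi> \<in> space M"
    then have "norm (h \<xi>) * norm (f \<xi>) \<le> (C * exp (- c * norm \<xi>)) * norm (f \<xi>)"
      by (intro mult_right_mono le) auto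
    then show "norm (h \<xi> * f \<xi>) \<le> norm (C * (exp (- c * norm \<xi>) * norm (f \<xi>)))"
      by (simp add: norm_mult mult.assoc order.trans[OF _ abs_ge_self] del: abs_mult)
  qed
qed

lemma norm_exp_bilin_le:
  assumes z: "z \<in> tube \<Omega>"
  obtains c where "c > 0"
    "\<And>\<xi>. \<xi> \<in> dual_cone \<Omega> \<Longrightarrow> norm (exp (\<i> * bilin z \<xi>)) \<le> exp (- c * norm \<xi>)"
proof -
  obtain c where "c > 0" "\<And>\<xi>. \<xi> \<in> dual_cone \<Omega> \<Longrightarrow> c * norm \<xi> \<le> (\<chi> j. Im (z $ j)) \<bullet> \<xi>"
    using z dual_cone_coercive[of "\<chi> j. Im (z $ j)"] by (auto simp: tube_def)
  then show ?thesis
    by (intro that[of c]) (auto simp: norm_exp_bilin simp del: norm_exp_eq_Re)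
qed

lemma integrable_laplace:
  assumes f: "f \<in> weighted_L2 \<Omega> \<rho> n" and z: "z \<in> tube \<Omega>"
  shows "integrable M (\<lambda>\<xi>. exp (\<i> * bilin z \<xi>) * f \<xi>)"
proof -
  obtain c where c: "c > 0"
    "\<And>\<xi>. \<xi> \<in> dual_cone \<Omega> \<Longrightarrow> norm (exp (\<i> * bilin z \<xi>)) \<le> exp (- c * norm \<xi>)"
    using norm_exp_bilin_le[OF z] by blast
  show ?thesis
    by (rule weighted_L2_integrable_mult[OF f c(1), where C=1])
       (use c(2) in \<open>auto intro!: continuous_intros\<close>)
qed

text \<open>
  The candidate derivative \<open>D\<close> is obtained by differentiating under the integral. Rather than
  justify the interchange by a limit theorem, the proof bounds the remainder quadratically: for
  \<open>|h| \<le> c / 4\<close>, with \<open>c\<close> the decay rate at \<open>z\<close>, the second-order Taylor estimate of the exponential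
  costs a factor \<open>|h|\<^sup>2 |\<xi>|\<^sup>2 exp (c |\<xi>| / 4)\<close>, and absorbing \<open>|\<xi>|\<^sup>2\<close> costs \<open>exp (c |\<xi>| / 2)\<close>, which leaves
  the decay \<open>exp (- c |\<xi>| / 4)\<close>.
\<close>

lemma holomorphic_laplace:
  assumes f: "f \<in> weighted_L2 \<Omega> \<rho> n"
  shows "holomorphic_vec_on (laplace \<Omega> f) (tube \<Omega>)"
  unfolding holomorphic_vec_on_def
proof
  fix z assume z: "z \<in> tube \<Omega>"
  obtain c where c: "c > 0"
    "\<And>\<xi>. \<xi> \<in> dual_cone \<Omega> \<Longrightarrow> norm (exp (\<i> * bilin z \<xi>)) \<le> exp (- c * norm \<xi>)"
    using norm_exp_bilin_le[OF z] by blast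
  define k where "k v \<xi> = \<i> * bilin v \<xi> * exp (\<i> * bilin z \<xi>)" for v \<xi>
  define D where "D v = (LINT \<xi>|M. k v \<xi> * f \<xi>)" for v
  have poly1: "t \<le> (2 / c) * exp (c * t / 2)" for t
  proof -
    have "c * t / 2 \<le> exp (c * t / 2)"
      using exp_ge_add_one_self[of "c * t / 2"] by linarith
    then show ?thesis using c(1) by (simp add: field_simps)
  qed
  have poly2: "t\<^sup>2 \<le> (4 / c)\<^sup>2 * exp (c * t / 2)" if "t \<ge> 0" for t
  proof -
    have "c * t / 4 \<le> exp (c * t / 4)"
      using exp_ge_add_one_self[of "c * t / 4"] by linarith
    then have "t \<le> (4 / c) * exp (c * t / 4)"
      using c(1) by (simp add: field_simps)
    then have "t\<^sup>2 \<le> ((4 / c) * exp (c * t / 4))\<^sup>2"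
      using that by (rule power_mono)
    also have "\<dots> = (4 / c)\<^sup>2 * exp (c * t / 2)"
      by (simp add: power_mult_distrib power_divide exp_double[symmetric])
    finally show ?thesis .
  qed
  have k_le: "norm (k v \<xi>) \<le> (norm v * (2 / c)) * exp (- (c / 2) * norm \<xi>)" 
    if \<xi>: "\<xi> \<in> dual_cone \<Omega>" for v \<xi>
  proof -
    have "norm (k v \<xi>) = norm (bilin v \<xi>) * norm (exp (\<i> * bilin z \<xi>))"
      unfolding k_def norm_mult by simp
    also have "\<dots> \<le> (norm v * norm \<xi>) * exp (- c * norm \<xi>)"
      by (intro mult_mono c(2)[OF \<xi>] norm_bilin_le) auto
    also have "\<dots> \<le> (norm v * ((2 / c) * exp (c * norm \<xi> / 2))) * exp (- c * norm \<xi>)"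
      by (intro mult_left_mono mult_right_mono poly1) auto
    also have "\<dots> = (norm v * (2 / c)) * (exp (c * norm \<xi> / 2) * exp (- c * norm \<xi>))"
      by (simp only: mult_ac)
    also have "exp (c * norm \<xi> / 2) * exp (- c * norm \<xi>) = exp (- (c / 2) * norm \<xi>)"
      by (simp add: exp_add[symmetric])
    finally show ?thesis .
  qed
  have k_cont: "continuous_on A (k v)" for A v
    unfolding k_def by (intro continuous_intros)
  have k_int: "integrable M (\<lambda>\<xi>. k v \<xi> * f \<xi>)" for v
    by (rule weighted_L2_integrable_mult[OF f _ k_cont k_le]) (use c in auto)
  have "linear D"
  proof (rule linearI)
    show "D (v + w) = D v + D w" for v w
    proof -
      have "D (v + w) = (LINT \<xi>|M. k v \<xi> * f \<xi> + k w \<xi> * f \<xi>)"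
        unfolding D_def k_def by (simp add: bilin_add algebra_simps)
      then show ?thesis
        unfolding D_def using k_int by (simp add: Bochner_Integration.integral_add)
    qed
    show "D (r *\<^sub>R v) = r *\<^sub>R D v" for r v
    proof -
      have "D (r *\<^sub>R v) = (LINT \<xi>|M. r *\<^sub>R (k v \<xi> * f \<xi>))"
        unfolding D_def k_def by (simp add: bilin_scaleR)
      then show ?thesis
        unfolding D_def by simp
    qed
  qed
  then have D_bl: "bounded_linear D"
    by (simp add: linear_conv_bounded_linear)
  have D_complex: "D (a *s v) = a * D v" for a v
  proof -
    have "D (a *s v) = (LINT \<xi>|M. a * (k v \<xi> * f \<xi>))"
      unfolding D_def k_def by (simp add: bilin_scale mult_ac)
    then show ?thesis
      unfolding D_def by simp
  qed
  define B where "B = (LINT \<xi>|M. exp (- (c / 4) * norm \<xi>) * norm (f \<xi>))"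
  have int4: "integrable M (\<lambda>\<xi>. exp (- (c / 4) * norm \<xi>) * norm (f \<xi>))"
    by (rule weighted_L2_integrable_exp[OF f]) (use c in auto)
  have remainder: "norm ((laplace \<Omega> f w - laplace \<Omega> f z) - D (w - z)) \<le> (4 / c)\<^sup>2 * B * (norm (w - z))\<^sup>2"
    if w: "w \<in> tube \<Omega>" "dist w z < c / 4" for w
  proof -
    define h where "h = w - z"
    have h: "norm h \<le> c / 4" using w by (simp add: h_def dist_norm)
    have int: "integrable M (\<lambda>\<xi>. exp (\<i> * bilin w \<xi>) * f \<xi> - exp (\<i> * bilin z \<xi>) * f \<xi> - k h \<xi> * f \<xi>)"
      by (intro Bochner_Integration.integrable_diff integrable_laplace[OF f] k_int w z)
    have eq: "(laplace \<Omega> f w - laplace \<Omega> f z) - D h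
        = (LINT \<xi>|M. exp (\<i> * bilin w \<xi>) * f \<xi> - exp (\<i> * bilin z \<xi>) * f \<xi> - k h \<xi> * f \<xi>)"
      using w z integrable_laplace[OF f w(1)] integrable_laplace[OF f z] k_int[of h]
      by (simp add: laplace_def D_def)
    have pt: "norm (exp (\<i> * bilin w \<xi>) * f \<xi> - exp (\<i> * bilin z \<xi>) * f \<xi> - k h \<xi> * f \<xi>)
        \<le> ((4 / c)\<^sup>2 * (norm h)\<^sup>2) * (exp (- (c / 4) * norm \<xi>) * norm (f \<xi>))"
      if \<xi>: "\<xi> \<in> dual_cone \<Omega>" for \<xi>
    proof -
      let ?b = "\<i> * bilin h \<xi>" and ?e = "exp (\<i> * bilin z \<xi>)"
      have b: "norm ?b \<le> norm h * norm \<xi>"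
        using norm_bilin_le[of h \<xi>] by (simp add: norm_mult)
      also have "\<dots> \<le> c / 4 * norm \<xi>"
        using h by (intro mult_right_mono) auto
      finally have b': "norm ?b \<le> c * norm \<xi> / 4" by simp
      have "exp (\<i> * bilin w \<xi>) = ?e * exp ?b"
        by (simp add: h_def bilin_diff exp_add[symmetric] algebra_simps)
      then have "exp (\<i> * bilin w \<xi>) * f \<xi> - ?e * f \<xi> - k h \<xi> * f \<xi> = ?e * (exp ?b - 1 - ?b) * f \<xi>"
        by (simp add: k_def algebra_simps)
      then have "norm (exp (\<i> * bilin w \<xi>) * f \<xi> - ?e * f \<xi> - k h \<xi> * f \<xi>)
          = norm ?e * norm (exp ?b - 1 - ?b) * norm (f \<xi>)"
        by (simp only: norm_mult)
      also have "\<dots> \<le> exp (- c * norm \<xi>) * (exp (c * norm \<xi> / 4) * (norm h * norm \<xi>)\<^sup>2) * norm (f \<xi>)"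
        using b b' c(2)[OF \<xi>]
        by (intro mult_right_mono mult_mono order.trans[OF norm_exp_minus_affine_le] power_mono) auto
      also have "\<dots> \<le> exp (- c * norm \<xi>) * (exp (c * norm \<xi> / 4) *
          ((norm h)\<^sup>2 * ((4 / c)\<^sup>2 * exp (c * norm \<xi> / 2)))) * norm (f \<xi>)"
        unfolding power_mult_distrib
        by (intro mult_right_mono mult_left_mono poly2) auto
      also have "\<dots> = ((4 / c)\<^sup>2 * (norm h)\<^sup>2) *
          ((exp (- c * norm \<xi>) * (exp (c * norm \<xi> / 4) * exp (c * norm \<xi> / 2))) * norm (f \<xi>))"
        by (simp only: mult_ac)
      also have "exp (- c * norm \<xi>) * (exp (c * norm \<xi> / 4) * exp (c * norm \<xi> / 2)) = exp (- (c / 4) * norm \<xi>)"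
        by (simp add: exp_add[symmetric])
      finally show ?thesis .
    qed
    have "norm ((laplace \<Omega> f w - laplace \<Omega> f z) - D h) \<le>
        (LINT \<xi>|M. norm (exp (\<i> * bilin w \<xi>) * f \<xi> - exp (\<i> * bilin z \<xi>) * f \<xi> - k h \<xi> * f \<xi>))"
      unfolding eq by (rule integral_norm_bound)
    also have "\<dots> \<le> (LINT \<xi>|M. ((4 / c)\<^sup>2 * (norm h)\<^sup>2) * (exp (- (c / 4) * norm \<xi>) * norm (f \<xi>)))"
      by (intro integral_mono integrable_norm int integrable_mult_right int4 pt) auto
    also have "\<dots> = ((4 / c)\<^sup>2 * (norm h)\<^sup>2) * B"
      unfolding B_def by (rule integral_mult_right_zero)
    finally show ?thesis by (simp add: h_def mult_ac)
  qed
  have "(laplace \<Omega> f has_derivative D) (at z within tube \<Omega>)"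
  proof (rule has_derivativeI_sandwich[where e="c / 4" and H="\<lambda>w. (4 / c)\<^sup>2 * B * norm (w - z)"])
    show "0 < c / 4" using c by simp
    show "bounded_linear D" by (rule D_bl)
    show "norm ((laplace \<Omega> f w - laplace \<Omega> f z) - D (w - z)) / norm (w - z) \<le> (4 / c)\<^sup>2 * B * norm (w - z)"
      if "w \<in> tube \<Omega>" "w \<noteq> z" "dist w z < c / 4" for w
      using remainder[of w] that by (simp add: divide_le_eq power2_eq_square mult.assoc)
    have "((\<lambda>w. (4 / c)\<^sup>2 * B * norm (w - z)) \<longlongrightarrow> (4 / c)\<^sup>2 * B * norm (z - z)) (at z within tube \<Omega>)"
      by (intro tendsto_intros)
    then show "((\<lambda>w. (4 / c)\<^sup>2 * B * norm (w - z)) \<longlongrightarrow> 0) (at z within tube \<Omega>)" by simp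
  qed
  then show "\<exists>D. (laplace \<Omega> f has_derivative D) (at z within tube \<Omega>) \<and> (\<forall>c v. D (c *s v) = c * D v)"
    using D_complex by blast
qed

end

section \<open>Injectivity of the Laplace transform\<close>

lemma borel_measurable_cnj:
  "f \<in> borel_measurable N \<Longrightarrow> (\<lambda>x. cnj (f x)) \<in> borel_measurable N"
  by (rule measurable_compose[OF _ borel_measurable_continuous_onI]) (auto intro: continuous_intros)

context open_cone
begin

text \<open>
  A substitute for Fourier uniqueness that only needs Weierstrass approximation. Fix \<open>y0 \<in> \<Omega>\<close> and
  nearby points \<open>u j = y0 + \<epsilon> e\<^sub>j\<close> of \<open>\<Omega>\<close>, and let \<open>E\<close> send \<open>\<xi>\<close> to the values at \<open>\<xi>\<close> of the corresponding
  exponentials. On the dual cone \<open>E\<close> takes values in a unit cube, because the exponents are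
  nonpositive. Since \<open>\<Omega>\<close> is closed under addition, \<open>g = exp (- (y0 \<bullet> \<cdot>)) f\<close> is orthogonal to \<open>p \<circ> E\<close>
  for each polynomial \<open>p\<close>, hence to the pointwise limits of such functions that stay bounded. The
  quotient of the \<open>j\<close>-th value by the one for \<open>y0\<close> is \<open>exp (- \<epsilon> \<xi>\<^sub>j)\<close>, so an orthant in \<open>\<xi>\<close> is the
  preimage under \<open>E\<close> of a closed set \<open>C\<close>, and its indicator is such a limit.
\<close>

lemma AE_eq_0_if_real_laplace_eq_0:
  fixes f :: "real ^ 'd \<Rightarrow> complex"
  assumes f: "\<And>y. y \<in> \<Omega> \<Longrightarrow> has_bochner_integral M (\<lambda>\<xi>. exp (- (y \<bullet> \<xi>)) *\<^sub>R f \<xi>) 0"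
  shows "AE \<xi> in M. f \<xi> = 0"
proof -
  obtain y0 where y0: "y0 \<in> \<Omega>" using nonempty by blast
  obtain \<epsilon> where \<epsilon>: "\<epsilon> > 0" "cball y0 \<epsilon> \<subseteq> \<Omega>"
    using open_Omega y0 by (meson open_contains_cball)
  define u where "u j = y0 + \<epsilon> *\<^sub>R axis j 1" for j
  have u: "u j \<in> \<Omega>" for j
    using \<epsilon> by (intro subsetD[OF \<epsilon>(2)]) (simp add: u_def dist_norm)
  define E :: "real ^ 'd \<Rightarrow> (real ^ 'd) \<times> real"
    where "E \<xi> = ((\<chi> j. exp (- (u j \<bullet> \<xi>))), exp (- (y0 \<bullet> \<xi>)))" for \<xi>
  \<comment> \<open>Asking for all \<open>y \<in> \<Omega>\<close> at once makes the class stable under multiplication by exponentials,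
    and so lets polynomials act on it by induction on their structure.\<close>
  define annihilates where "annihilates k \<longleftrightarrow>
      (\<forall>y\<in>\<Omega>. has_bochner_integral M (\<lambda>\<xi>. (exp (- (y \<bullet> \<xi>)) * k \<xi>) *\<^sub>R f \<xi>) 0)" for k
  have ann_1: "annihilates (\<lambda>_. 1)"
    using f by (simp add: annihilates_def)
  have ann_scale: "annihilates (\<lambda>\<xi>. k \<xi> * c)" if "annihilates k" for k c
    unfolding annihilates_def
  proof
    fix y assume "y \<in> \<Omega>"
    with that have "has_bochner_integral M (\<lambda>\<xi>. c *\<^sub>R ((exp (- (y \<bullet> \<xi>)) * k \<xi>) *\<^sub>R f \<xi>)) (c *\<^sub>R 0)"
      unfolding annihilates_def by (intro has_bochner_integral_scaleR_right) auto
    then show "has_bochner_integral M (\<lambda>\<xi>. (exp (- (y \<bullet> \<xi>)) * (k \<xi> * c)) *\<^sub>R f \<xi>) 0"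
      by (simp add: mult_ac)
  qed
  have ann_add: "annihilates (\<lambda>\<xi>. k \<xi> + l \<xi>)" if "annihilates k" "annihilates l" for k l
    unfolding annihilates_def
  proof
    fix y assume "y \<in> \<Omega>"
    with that have "has_bochner_integral M (\<lambda>\<xi>. (exp (- (y \<bullet> \<xi>)) * k \<xi>) *\<^sub>R f \<xi>
        + (exp (- (y \<bullet> \<xi>)) * l \<xi>) *\<^sub>R f \<xi>) (0 + 0)"
      unfolding annihilates_def by (intro has_bochner_integral_add) auto
    then show "has_bochner_integral M (\<lambda>\<xi>. (exp (- (y \<bullet> \<xi>)) * (k \<xi> + l \<xi>)) *\<^sub>R f \<xi>) 0"
      by (simp add: distrib_left scaleR_left_distrib)
  qed
  have ann_sum: "annihilates (\<lambda>\<xi>. \<Sum>j\<in>J. k j \<xi>)" if "finite J" "\<And>j. annihilates (k j)"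
    for J :: "'d set" and k
    using that(1)
  proof (induction J rule: finite_induct)
    case empty
    then show ?case using ann_scale[OF ann_1, of 0] by simp
  next
    case (insert j J)
    then show ?case using ann_add[OF that(2)] by simp
  qed
  have ann_exp: "annihilates (\<lambda>\<xi>. k \<xi> * exp (- (v \<bullet> \<xi>)))" if "annihilates k" "v \<in> \<Omega>" for k v
    unfolding annihilates_def
  proof
    fix y assume "y \<in> \<Omega>"
    then have "has_bochner_integral M (\<lambda>\<xi>. (exp (- ((y + v) \<bullet> \<xi>)) * k \<xi>) *\<^sub>R f \<xi>) 0"
      using that add_closed unfolding annihilates_def by blast
    then show "has_bochner_integral M (\<lambda>\<xi>. (exp (- (y \<bullet> \<xi>)) * (k \<xi> * exp (- (v \<bullet> \<xi>)))) *\<^sub>R f \<xi>) 0"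
      by (simp add: inner_add_left exp_add exp_diff exp_minus divide_inverse mult_ac)
  qed
  have ann_poly: "annihilates (\<lambda>\<xi>. k \<xi> * p (E \<xi>))"
    if "real_polynomial_function p" "annihilates k" for p k
    using that
  proof (induction p arbitrary: k rule: real_polynomial_function.induct)
    case (linear p)
    note k = linear(2)
    interpret bounded_linear p by fact
    have "E \<xi> = (\<Sum>j\<in>UNIV. exp (- (u j \<bullet> \<xi>)) *\<^sub>R (axis j 1, 0)) + exp (- (y0 \<bullet> \<xi>)) *\<^sub>R (0, 1)" for \<xi>
      by (simp add: E_def prod_eq_iff fst_sum snd_sum vec_eq_iff axis_def if_distrib sum.If_cases cong: if_cong)
    then have "p (E \<xi>) = (\<Sum>j\<in>UNIV. exp (- (u j \<bullet> \<xi>)) * p (axis j 1, 0)) + exp (- (y0 \<bullet> \<xi>)) * p (0, 1)" for \<xi>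
      by (simp only: add sum scaleR) (simp only: real_scaleR_def)
    then have eq: "k \<xi> * p (E \<xi>) = (\<Sum>j\<in>UNIV. k \<xi> * exp (- (u j \<bullet> \<xi>)) * p (axis j 1, 0))
        + k \<xi> * exp (- (y0 \<bullet> \<xi>)) * p (0, 1)" for \<xi>
      by (simp add: distrib_left sum_distrib_left mult.assoc)
    show ?case
      unfolding eq by (intro ann_add ann_sum ann_scale ann_exp k u y0) simp
  next
    case (const c)
    then show ?case by (rule ann_scale)
  next
    case (add p q)
    then show ?case using ann_add[OF add.IH(1) add.IH(2)] by (simp add: distrib_left)
  next
    case (mult p q)
    show ?case using mult.IH(2)[OF mult.IH(1)[OF mult.prems]] by (simp add: mult.assoc)
  qed
  define g where "g \<xi> = exp (- (y0 \<bullet> \<xi>)) *\<^sub>R f \<xi>" for \<xi>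
  have g: "integrable M g"
    using f[OF y0] unfolding g_def by (rule integrable.intros)
  have g_total: "(LINT \<xi>|M. g \<xi>) = 0"
    using f[OF y0] unfolding g_def by (rule has_bochner_integral_integral_eq)
  have g_poly: "(LINT \<xi>|M. p (E \<xi>) *\<^sub>R g \<xi>) = 0" if "real_polynomial_function p" for p
  proof -
    have "has_bochner_integral M (\<lambda>\<xi>. (exp (- (y0 \<bullet> \<xi>)) * (1 * p (E \<xi>))) *\<^sub>R f \<xi>) 0"
      using ann_poly[OF that ann_1] y0 unfolding annihilates_def by blast
    then have "has_bochner_integral M (\<lambda>\<xi>. p (E \<xi>) *\<^sub>R g \<xi>) 0"
      by (simp add: g_def mult.commute)
    then show ?thesis by (rule has_bochner_integral_integral_eq)
  qed
  have E_cont: "continuous_on A E" for A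
    unfolding E_def by (intro continuous_intros)
  define K :: "((real ^ 'd) \<times> real) set" where "K = cbox 0 (\<chi> j. 1) \<times> cbox 0 1"
  have K: "compact K" unfolding K_def by (intro compact_Times compact_cbox)
  have E_K: "E \<xi> \<in> K" if "\<xi> \<in> dual_cone \<Omega>" for \<xi>
    using that u y0 by (auto simp: E_def K_def mem_box_cart dual_cone_def)
  have "(LINT \<xi>|M. indicator {..a} \<xi> *\<^sub>R g \<xi>) = 0" for a
  proof -
    \<comment> \<open>the condition \<open>\<xi>\<^sub>j \<le> a\<^sub>j\<close> in terms of \<open>E \<xi>\<close>, cleared of denominators\<close>
    define C :: "((real ^ 'd) \<times> real) set"
      where "C = {q. \<forall>j. snd q * exp (- (\<epsilon> * a $ j)) \<le> fst q $ j}"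
    have "C = (\<Inter>j. {q. snd q * exp (- (\<epsilon> * a $ j)) \<le> fst q $ j})"
      by (auto simp: C_def)
    then have C: "closed C"
      by (auto intro!: closed_INT closed_Collect_le continuous_intros)
    have "0 \<in> C" by (simp add: C_def)
    then have C_ne: "C \<noteq> {}" by blast
    have E_C: "E \<xi> \<in> C \<longleftrightarrow> \<xi> \<in> {..a}" for \<xi>
      using \<epsilon>(1) by (simp add: C_def E_def u_def less_eq_vec_def exp_add[symmetric] inner_add_left
          inner_axis' del: exp_add)
    \<comment> \<open>continuous functions with values in \<open>{0..1}\<close> that tend pointwise to the indicator of \<open>C\<close>\<close>
    define h where "h n q = (1 / (1 + infdist q C)) ^ n" for n :: nat and q
    have h_cont: "continuous_on K (h n)" for n
    proof -
      have "1 + infdist q C \<noteq> 0" for q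
        using infdist_nonneg[of q C] by linarith
      then show ?thesis
        unfolding h_def by (intro continuous_intros) auto
    qed
    have h_le: "0 \<le> h n q" "h n q \<le> 1" for n q
      using infdist_nonneg[of q C] by (auto simp: h_def intro!: power_le_one)
    have h_lim: "(\<lambda>n. h n q) \<longlonglongrightarrow> indicator C q" for q
    proof (cases "q \<in> C")
      case True
      then show ?thesis by (simp add: h_def)
    next
      case False
      then have "infdist q C > 0"
        using C C_ne by (simp add: infdist_pos_not_in_closed)
      then have "(\<lambda>n. h n q) \<longlonglongrightarrow> 0"
        unfolding h_def by (intro LIMSEQ_realpow_zero) auto
      then show ?thesis using False by simp
    qed
    have "\<exists>p. real_polynomial_function p \<and> (\<forall>q\<in>K. \<bar>h n q - p q\<bar> < inverse (Suc n))" for n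
    proof -
      have "0 < inverse (real (Suc n))" by simp
      from Stone_Weierstrass_real_polynomial_function[OF K h_cont[of n] this]
      obtain p where "real_polynomial_function p" "\<And>q. q \<in> K \<Longrightarrow> \<bar>h n q - p q\<bar> < inverse (real (Suc n))"
        by blast
      then show ?thesis by blast
    qed
    then obtain p where "\<forall>n. real_polynomial_function (p n) \<and>
        (\<forall>q\<in>K. \<bar>h n q - p n q\<bar> < inverse (Suc n))"
      using choice[of "\<lambda>n p. real_polynomial_function p \<and> (\<forall>q\<in>K. \<bar>h n q - p q\<bar> < inverse (Suc n))"]
      by blast
    then have p: "real_polynomial_function (p n)"
      "q \<in> K \<Longrightarrow> \<bar>h n q - p n q\<bar> < inverse (Suc n)" for n q
      by blast+
    have p_lim: "(\<lambda>n. p n q) \<longlonglongrightarrow> indicator C q" if "q \<in> K" for q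
    proof -
      have "(\<lambda>n. h n q - p n q) \<longlonglongrightarrow> 0"
        using p(2)[OF that]
        by (intro Lim_null_comparison[OF _ LIMSEQ_inverse_real_of_nat] always_eventually) (auto simp: less_imp_le)
      from tendsto_diff[OF h_lim[of q] this] show ?thesis by simp
    qed
    have p_le: "\<bar>p n q\<bar> \<le> 2" if "q \<in> K" for n q
    proof -
      have "inverse (real (Suc n)) \<le> 1" by (simp add: inverse_le_1_iff)
      then show ?thesis using p(2)[OF that, of n] h_le[of n q] by linarith
    qed
    have E_meas: "(\<lambda>\<xi>. p n (E \<xi>)) \<in> borel_measurable M" for n
    proof -
      have "continuous_on UNIV (p n)"
        using p(1)[of n] by (simp add: real_polynomial_function_eq continuous_on_polymonial_function)
      then show ?thesis
        by (intro borel_measurable_continuous continuous_on_compose2[OF _ E_cont]) auto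
    qed
    have "(\<lambda>n. LINT \<xi>|M. p n (E \<xi>) *\<^sub>R g \<xi>) \<longlonglongrightarrow> (LINT \<xi>|M. indicator {..a} \<xi> *\<^sub>R g \<xi>)"
    proof (rule integral_dominated_convergence[where w="\<lambda>\<xi>. 2 * norm (g \<xi>)"])
      have "indicat_real {..a} \<in> borel_measurable M"
        by (intro measurable_restrict_space1 borel_measurable_indicator) auto
      then show "(\<lambda>\<xi>. indicat_real {..a} \<xi> *\<^sub>R g \<xi>) \<in> borel_measurable M"
        using g by (intro borel_measurable_scaleR) auto
      show "(\<lambda>\<xi>. p n (E \<xi>) *\<^sub>R g \<xi>) \<in> borel_measurable M" for n
        using g E_meas by (intro borel_measurable_scaleR) auto
      show "integrable M (\<lambda>\<xi>. 2 * norm (g \<xi>))" using g by auto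
      show "AE \<xi> in M. (\<lambda>n. p n (E \<xi>) *\<^sub>R g \<xi>) \<longlonglongrightarrow> indicat_real {..a} \<xi> *\<^sub>R g \<xi>"
      proof (rule AE_I2)
        fix \<xi> assume "\<xi> \<in> space M"
        then have "E \<xi> \<in> K" using E_K by simp
        moreover have "indicat_real C (E \<xi>) = indicat_real {..a} \<xi>"
          using E_C by (simp add: indicator_def)
        ultimately show "(\<lambda>n. p n (E \<xi>) *\<^sub>R g \<xi>) \<longlonglongrightarrow> indicat_real {..a} \<xi> *\<^sub>R g \<xi>"
          using p_lim[of "E \<xi>"] by (intro tendsto_intros) auto
      qed
      show "AE \<xi> in M. norm (p n (E \<xi>) *\<^sub>R g \<xi>) \<le> 2 * norm (g \<xi>)" for n
        by (intro AE_I2) (auto intro!: mult_right_mono p_le E_K)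
    qed
    then have "(\<lambda>_. 0) \<longlonglongrightarrow> (LINT \<xi>|M. indicator {..a} \<xi> *\<^sub>R g \<xi>)"
      by (simp only: g_poly p(1))
    then show ?thesis
      using LIMSEQ_unique tendsto_const by metis
  qed
  then have "AE \<xi> in M. g \<xi> = 0"
    by (intro AE_eq_0_if_integral_atMost_eq_0 g g_total) auto
  then show ?thesis by eventually_elim (simp add: g_def)
qed

lemma laplace_imaginary:
  assumes f: "f \<in> weighted_L2 \<Omega> \<rho> n" and y: "y \<in> \<Omega>"
  shows "has_bochner_integral M (\<lambda>\<xi>. exp (- (y \<bullet> \<xi>)) *\<^sub>R f \<xi>)
    (laplace \<Omega> f (\<chi> j. \<i> * complex_of_real (y $ j)))"
proof -
  have z: "(\<chi> j. \<i> * complex_of_real (y $ j)) \<in> tube \<Omega>"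
    using y by (simp add: tube_def)
  from has_bochner_integral_integrable[OF integrable_laplace[OF f z]] z show ?thesis
    by (simp add: laplace_def exp_bilin_imaginary scaleR_conv_of_real)
qed

lemma laplace_inject:
  assumes "f \<in> weighted_L2 \<Omega> \<rho> n" "g \<in> weighted_L2 \<Omega> \<rho> n" "laplace \<Omega> f = laplace \<Omega> g"
  shows "AE \<xi> in M. f \<xi> = g \<xi>"
proof -
  have "AE \<xi> in M. f \<xi> - g \<xi> = 0"
  proof (rule AE_eq_0_if_real_laplace_eq_0)
    fix y assume "y \<in> \<Omega>"
    with assms show "has_bochner_integral M (\<lambda>\<xi>. exp (- (y \<bullet> \<xi>)) *\<^sub>R (f \<xi> - g \<xi>)) 0"
      using has_bochner_integral_diff[OF laplace_imaginary[of f \<rho> n y] laplace_imaginary[of g \<rho> n y]]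
      by (simp add: scaleR_diff_right)
  qed
  then show ?thesis by simp
qed

end

section \<open>The reproducing kernel and adjoints\<close>

locale weighted_open_cone = open_cone \<Omega> for \<Omega> :: "(real ^ 'd::finite) set" +
  fixes \<rho> :: "real ^ 'd \<Rightarrow> real" and n :: nat
  assumes continuous_weight: "continuous_on (dual_cone \<Omega>) (weight \<rho> n)"
begin

lemma weight_measurable: "(\<lambda>\<xi>. complex_of_real (weight \<rho> n \<xi>)) \<in> borel_measurable M"
  by (intro borel_measurable_continuous continuous_intros continuous_weight)

text \<open>
  By injectivity of the transform, any two choices of densities agree almost everywhere, so the
  description in the definition determines a unique number.
\<close>

lemma hs_inner_laplace:
  assumes f: "f \<in> weighted_L2 \<Omega> \<rho> n" and g: "g \<in> weighted_L2 \<Omega> \<rho> n"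
  shows "hs_inner \<Omega> \<rho> n (laplace \<Omega> f) (laplace \<Omega> g) =
    (LINT \<xi>|M. f \<xi> * cnj (g \<xi>) * complex_of_real (weight \<rho> n \<xi>))"
  unfolding hs_inner_def
proof (rule the_equality)
  show "\<exists>f'\<in>weighted_L2 \<Omega> \<rho> n. \<exists>g'\<in>weighted_L2 \<Omega> \<rho> n. laplace \<Omega> f = laplace \<Omega> f' \<and> laplace \<Omega> g = laplace \<Omega> g' \<and>
      (LINT \<xi>|M. f \<xi> * cnj (g \<xi>) * complex_of_real (weight \<rho> n \<xi>)) =
      (LINT \<xi>|M. f' \<xi> * cnj (g' \<xi>) * complex_of_real (weight \<rho> n \<xi>))"
    using f g by blast
next
  fix c
  assume "\<exists>f'\<in>weighted_L2 \<Omega> \<rho> n. \<exists>g'\<in>weighted_L2 \<Omega> \<rho> n. laplace \<Omega> f = laplace \<Omega> f' \<and> laplace \<Omega> g = laplace \<Omega> g' \<and>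
      c = (LINT \<xi>|M. f' \<xi> * cnj (g' \<xi>) * complex_of_real (weight \<rho> n \<xi>))"
  then obtain f' g' where f': "f' \<in> weighted_L2 \<Omega> \<rho> n" "laplace \<Omega> f = laplace \<Omega> f'"
    and g': "g' \<in> weighted_L2 \<Omega> \<rho> n" "laplace \<Omega> g = laplace \<Omega> g'"
    and c: "c = (LINT \<xi>|M. f' \<xi> * cnj (g' \<xi>) * complex_of_real (weight \<rho> n \<xi>))"
    by blast
  have meas: "f \<in> borel_measurable M" "g \<in> borel_measurable M"
    "f' \<in> borel_measurable M" "g' \<in> borel_measurable M"
    using f g f' g' by (auto simp: weighted_L2_def)
  show "c = (LINT \<xi>|M. f \<xi> * cnj (g \<xi>) * complex_of_real (weight \<rho> n \<xi>))"
    unfolding c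
  proof (rule integral_cong_AE)
    show "AE \<xi> in M. f' \<xi> * cnj (g' \<xi>) * complex_of_real (weight \<rho> n \<xi>) =
        f \<xi> * cnj (g \<xi>) * complex_of_real (weight \<rho> n \<xi>)"
      using laplace_inject[OF f f'] laplace_inject[OF g g'] by eventually_elim simp
  qed (intro borel_measurable_times borel_measurable_cnj weight_measurable meas)+
qed

lemma laplace_in_hardy_sobolev:
  "f \<in> weighted_L2 \<Omega> \<rho> n \<Longrightarrow> laplace \<Omega> f \<in> hardy_sobolev \<Omega> \<rho> n"
  by (auto simp: hardy_sobolev_def holomorphic_laplace)

lemma hardy_sobolevE:
  assumes "F \<in> hardy_sobolev \<Omega> \<rho> n"
  obtains f where "f \<in> weighted_L2 \<Omega> \<rho> n" "F = laplace \<Omega> f"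
  using assms by (auto simp: hardy_sobolev_def)

lemma hs_inner_commute:
  assumes "F \<in> hardy_sobolev \<Omega> \<rho> n" "G \<in> hardy_sobolev \<Omega> \<rho> n"
  shows "hs_inner \<Omega> \<rho> n F G = cnj (hs_inner \<Omega> \<rho> n G F)"
proof -
  obtain f g where fg: "f \<in> weighted_L2 \<Omega> \<rho> n" "F = laplace \<Omega> f"
    "g \<in> weighted_L2 \<Omega> \<rho> n" "G = laplace \<Omega> g"
    using assms by (auto elim!: hardy_sobolevE)
  have "(LINT \<xi>|M. f \<xi> * cnj (g \<xi>) * complex_of_real (weight \<rho> n \<xi>)) =
      (LINT \<xi>|M. cnj (g \<xi> * cnj (f \<xi>) * complex_of_real (weight \<rho> n \<xi>)))"
    by (intro Bochner_Integration.integral_cong) (auto simp: mult_ac)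
  also have "\<dots> = cnj (LINT \<xi>|M. g \<xi> * cnj (f \<xi>) * complex_of_real (weight \<rho> n \<xi>))"
    by (rule Bochner_Integration.integral_cnj)
  finally show ?thesis
    using fg by (simp only: hs_inner_laplace)
qed

lemma weighted_L2_scale:
  assumes "f \<in> weighted_L2 \<Omega> \<rho> n"
  shows "(\<lambda>\<xi>. c * f \<xi>) \<in> weighted_L2 \<Omega> \<rho> n"
proof -
  have "integrable M (\<lambda>\<xi>. (cmod c)\<^sup>2 * ((cmod (f \<xi>))\<^sup>2 * weight \<rho> n \<xi>))"
    using assms by (intro integrable_mult_right) (simp add: weighted_L2_def)
  moreover have "(\<lambda>\<xi>. c * f \<xi>) \<in> borel_measurable M"
    using assms by (intro borel_measurable_times) (auto simp: weighted_L2_def)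
  ultimately show ?thesis
    by (simp add: weighted_L2_def norm_mult power_mult_distrib mult.assoc)
qed

lemma laplace_scale: "laplace \<Omega> (\<lambda>\<xi>. c * f \<xi>) = (\<lambda>z. c * laplace \<Omega> f z)"
  by (simp add: laplace_def fun_eq_iff mult.left_commute[of _ c])

lemma hardy_sobolev_scale:
  "F \<in> hardy_sobolev \<Omega> \<rho> n \<Longrightarrow> (\<lambda>z. c * F z) \<in> hardy_sobolev \<Omega> \<rho> n"
  using laplace_in_hardy_sobolev[OF weighted_L2_scale]
  by (auto elim!: hardy_sobolevE simp: laplace_scale[symmetric])

lemma hs_inner_scale_right:
  assumes "F \<in> hardy_sobolev \<Omega> \<rho> n" "G \<in> hardy_sobolev \<Omega> \<rho> n"
  shows "hs_inner \<Omega> \<rho> n F (\<lambda>z. c * G z) = cnj c * hs_inner \<Omega> \<rho> n F G"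
proof -
  obtain f g where fg: "f \<in> weighted_L2 \<Omega> \<rho> n" "F = laplace \<Omega> f"
    "g \<in> weighted_L2 \<Omega> \<rho> n" "G = laplace \<Omega> g"
    using assms by (auto elim!: hardy_sobolevE)
  then have "hs_inner \<Omega> \<rho> n F (\<lambda>z. c * G z) =
      (LINT \<xi>|M. cnj c * (f \<xi> * cnj (g \<xi>) * complex_of_real (weight \<rho> n \<xi>)))"
    by (simp add: hs_inner_laplace weighted_L2_scale laplace_scale[symmetric] mult_ac)
  then show ?thesis
    using fg by (simp add: hs_inner_laplace)
qed

text \<open>
  Solving \<open>exp (\<i> * bilin w \<xi>) * f \<xi> = f \<xi> * cnj (k \<xi>) * weight \<rho> n \<xi>\<close> for \<open>k\<close> gives the density whose
  transform represents evaluation at \<open>w\<close>.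
\<close>

definition kernel_density :: "complex ^ 'd \<Rightarrow> real ^ 'd \<Rightarrow> complex" where
  "kernel_density w \<xi> = cnj (exp (\<i> * bilin w \<xi>)) / complex_of_real (weight \<rho> n \<xi>)"

lemma weight_pos: "0 < weight \<rho> n \<xi>"
  using one_le_weight[of \<rho> n \<xi>] by linarith

lemma kernel_density_in_weighted_L2:
  assumes w: "w \<in> tube \<Omega>"
  shows "kernel_density w \<in> weighted_L2 \<Omega> \<rho> n"
proof -
  obtain c where c: "c > 0"
    "\<And>\<xi>. \<xi> \<in> dual_cone \<Omega> \<Longrightarrow> norm (exp (\<i> * bilin w \<xi>)) \<le> exp (- c * norm \<xi>)"
    using norm_exp_bilin_le[OF w] by blast
  have "(\<lambda>\<xi>. exp (\<i> * bilin w \<xi>)) \<in> borel_measurable M"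
    by (intro borel_measurable_continuous continuous_intros)
  then have meas: "kernel_density w \<in> borel_measurable M"
    unfolding kernel_density_def
    by (intro borel_measurable_divide borel_measurable_cnj weight_measurable)
  have w_meas: "weight \<rho> n \<in> borel_measurable M"
    by (rule borel_measurable_continuous[OF continuous_weight])
  have "integrable M (\<lambda>\<xi>. (cmod (kernel_density w \<xi>))\<^sup>2 * weight \<rho> n \<xi>)"
  proof (rule Bochner_Integration.integrable_bound)
    show "integrable M (\<lambda>\<xi>. exp (- (2 * c) * norm \<xi>))"
      using c by (intro integrable_exp_minus_norm_dual_cone) auto
    show "AE \<xi> in M. norm ((cmod (kernel_density w \<xi>))\<^sup>2 * weight \<rho> n \<xi>) \<le> norm (exp (- (2 * c) * norm \<xi>))"
    proof (rule AE_I2)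
      fix \<xi> assume "\<xi> \<in> space M"
      then have \<xi>: "\<xi> \<in> dual_cone \<Omega>" by simp
      let ?a = "norm (exp (\<i> * bilin w \<xi>))"
      have "(cmod (kernel_density w \<xi>))\<^sup>2 * weight \<rho> n \<xi> = ?a\<^sup>2 / weight \<rho> n \<xi>"
        using weight_pos[of \<xi>] unfolding kernel_density_def norm_divide complex_mod_cnj
        by (simp add: power_divide power2_eq_square del: norm_exp_eq_Re)
      also have "\<dots> \<le> ?a\<^sup>2 / 1"
        using one_le_weight[of \<rho> n \<xi>] by (intro divide_left_mono) auto
      also have "?a\<^sup>2 \<le> (exp (- c * norm \<xi>))\<^sup>2"
        by (intro power_mono c(2)[OF \<xi>]) auto
      also have "(exp (- c * norm \<xi>))\<^sup>2 = exp (- (2 * c) * norm \<xi>)"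
        by (simp add: exp_double[symmetric])
      finally show "norm ((cmod (kernel_density w \<xi>))\<^sup>2 * weight \<rho> n \<xi>) \<le> norm (exp (- (2 * c) * norm \<xi>))"
        using weight_pos[of \<xi>] by (simp add: abs_mult)
    qed
    show "(\<lambda>\<xi>. (cmod (kernel_density w \<xi>))\<^sup>2 * weight \<rho> n \<xi>) \<in> borel_measurable M"
      by (intro borel_measurable_times borel_measurable_power w_meas
          measurable_compose[OF meas borel_measurable_norm])
  qed
  then show ?thesis using meas by (simp add: weighted_L2_def)
qed

lemma reproducing_property:
  assumes F: "F \<in> hardy_sobolev \<Omega> \<rho> n" and w: "w \<in> tube \<Omega>"
  shows "hs_inner \<Omega> \<rho> n F (laplace \<Omega> (kernel_density w)) = F w"
proof -
  obtain f where f: "f \<in> weighted_L2 \<Omega> \<rho> n" "F = laplace \<Omega> f"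
    using F by (rule hardy_sobolevE)
  have eq: "f \<xi> * cnj (kernel_density w \<xi>) * complex_of_real (weight \<rho> n \<xi>) = exp (\<i> * bilin w \<xi>) * f \<xi>" for \<xi>
    using weight_pos[of \<xi>] by (simp add: kernel_density_def)
  then show ?thesis
    unfolding f(2) hs_inner_laplace[OF f(1) kernel_density_in_weighted_L2[OF w]] eq
    using w by (simp add: laplace_def)
qed

text \<open>
  Testing against the kernel at \<open>z\<close> recovers the conjugate of the value at \<open>z\<close>, and
  these inner products determine the function on the tube. Off the tube both functions vanish.
\<close>

lemma hardy_sobolev_eqI:
  assumes G: "G \<in> hardy_sobolev \<Omega> \<rho> n" and G': "G' \<in> hardy_sobolev \<Omega> \<rho> n"
    and eq: "\<And>F. F \<in> hardy_sobolev \<Omega> \<rho> n \<Longrightarrow> hs_inner \<Omega> \<rho> n F G = hs_inner \<Omega> \<rho> n F G'"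
  shows "G = G'"
proof
  fix z show "G z = G' z"
  proof (cases "z \<in> tube \<Omega>")
    case True
    let ?K = "laplace \<Omega> (kernel_density z)"
    have K: "?K \<in> hardy_sobolev \<Omega> \<rho> n"
      by (intro laplace_in_hardy_sobolev kernel_density_in_weighted_L2 True)
    have "G z = cnj (hs_inner \<Omega> \<rho> n ?K G)"
      using reproducing_property[OF G True] hs_inner_commute[OF G K] by simp
    also have "\<dots> = G' z"
      using reproducing_property[OF G' True] hs_inner_commute[OF G' K] eq[OF K] by simp
    finally show ?thesis .
  next
    case False
    with G G' show ?thesis by (auto elim!: hardy_sobolevE simp: laplace_def)
  qed
qed

lemma repr_kernel_eq:
  assumes w: "w \<in> tube \<Omega>"
  shows "repr_kernel \<Omega> \<rho> n w = laplace \<Omega> (kernel_density w)"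
  unfolding repr_kernel_def
proof (rule the_equality)
  show K: "laplace \<Omega> (kernel_density w) \<in> hardy_sobolev \<Omega> \<rho> n \<and>
      (\<forall>F\<in>hardy_sobolev \<Omega> \<rho> n. F w = hs_inner \<Omega> \<rho> n F (laplace \<Omega> (kernel_density w)))"
    using w by (simp add: laplace_in_hardy_sobolev kernel_density_in_weighted_L2 reproducing_property)
  show "K' = laplace \<Omega> (kernel_density w)" 
    if "K' \<in> hardy_sobolev \<Omega> \<rho> n \<and> (\<forall>F\<in>hardy_sobolev \<Omega> \<rho> n. F w = hs_inner \<Omega> \<rho> n F K')" for K'
    using that K by (intro hardy_sobolev_eqI) auto
qed

lemma repr_kernel_in_hardy_sobolev:
  "w \<in> tube \<Omega> \<Longrightarrow> repr_kernel \<Omega> \<rho> n w \<in> hardy_sobolev \<Omega> \<rho> n"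
  by (simp add: repr_kernel_eq laplace_in_hardy_sobolev kernel_density_in_weighted_L2)

lemma hs_inner_repr_kernel:
  "F \<in> hardy_sobolev \<Omega> \<rho> n \<Longrightarrow> w \<in> tube \<Omega> \<Longrightarrow> hs_inner \<Omega> \<rho> n F (repr_kernel \<Omega> \<rho> n w) = F w"
  by (simp add: repr_kernel_eq reproducing_property)

lemma hs_adjoint_eqI:
  assumes "G' \<in> hardy_sobolev \<Omega> \<rho> n"
    and "\<And>F. F \<in> hardy_sobolev \<Omega> \<rho> n \<Longrightarrow> hs_inner \<Omega> \<rho> n (A F) G = hs_inner \<Omega> \<rho> n F G'"
  shows "hs_adjoint \<Omega> \<rho> n A G = G'"
  unfolding hs_adjoint_def
  by (rule the_equality) (use assms in \<open>auto intro!: hardy_sobolev_eqI\<close>)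

end

section \<open>Adjoints of weighted composition operators on kernels\<close>

theorem proposition8p4:
  fixes \<Omega> :: "(real ^ 'd::finite) set"
    and \<rho> :: "real ^ 'd \<Rightarrow> real"
    and n :: nat
    and \<phi> :: "complex ^ 'd \<Rightarrow> complex ^ 'd"
    and \<psi> :: "complex ^ 'd \<Rightarrow> complex"
  assumes "\<Omega> \<noteq> {}" and "open \<Omega>" and "convex \<Omega>"
    and "\<And>x t. x \<in> \<Omega> \<Longrightarrow> t > 0 \<Longrightarrow> t *\<^sub>R x \<in> \<Omega>"
    and "\<not> (\<exists>a v. v \<noteq> 0 \<and> (\<forall>t::real. a + t *\<^sub>R v \<in> \<Omega>))"
    and "continuous_on (dual_cone \<Omega>) \<rho>"
    and "\<And>\<xi>. \<xi> \<in> dual_cone \<Omega> \<Longrightarrow> \<rho> \<xi> \<ge> 0"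
    and "\<And>\<xi>. \<xi> \<in> dual_cone \<Omega> \<Longrightarrow> \<xi> \<noteq> 0 \<Longrightarrow> \<rho> \<xi> > 0"
    and "\<And>t \<xi>. \<xi> \<in> dual_cone \<Omega> \<Longrightarrow> t > 0 \<Longrightarrow> \<rho> (t *\<^sub>R \<xi>) = t * \<rho> \<xi>"
    and "\<And>z. z \<in> tube \<Omega> \<Longrightarrow> \<phi> z \<in> tube \<Omega>"
    and "\<And>j. holomorphic_vec_on (\<lambda>z. \<phi> z $ j) (tube \<Omega>)"
    and "holomorphic_vec_on \<psi> (tube \<Omega>)"
    and "bounded_weighted_comp \<Omega> \<rho> n \<psi> \<phi>"
  shows "\<forall>w\<in>tube \<Omega>.
    hs_adjoint \<Omega> \<rho> n (weighted_comp \<Omega> \<psi> \<phi>) (repr_kernel \<Omega> \<rho> n w) =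
    (\<lambda>z. cnj (\<psi> w) * repr_kernel \<Omega> \<rho> n (\<phi> w) z)"
proof
  interpret weighted_open_cone \<Omega> \<rho> n
  proof
    show "x + y \<in> \<Omega>" if "x \<in> \<Omega>" "y \<in> \<Omega>" for x y
    proof -
      have "(1/2) *\<^sub>R x + (1/2) *\<^sub>R y \<in> \<Omega>"
        using \<open>convex \<Omega>\<close> that by (intro convexD) auto
      \<comment> \<open>double the midpoint\<close>
      from assms(4)[OF this, of 2] show ?thesis
        by (simp add: scaleR_add_right)
    qed
    show "continuous_on (dual_cone \<Omega>) (weight \<rho> n)"
      unfolding weight_def by (intro continuous_intros assms(6))
  qed (use assms in auto)
  fix w assume w: "w \<in> tube \<Omega>"
  let ?H = "hardy_sobolev \<Omega> \<rho> n" and ?W = "weighted_comp \<Omega> \<psi> \<phi>"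
  have \<phi>w: "\<phi> w \<in> tube \<Omega>" by (rule assms(10)[OF w])
  show "hs_adjoint \<Omega> \<rho> n ?W (repr_kernel \<Omega> \<rho> n w) = (\<lambda>z. cnj (\<psi> w) * repr_kernel \<Omega> \<rho> n (\<phi> w) z)"
  proof (rule hs_adjoint_eqI)
    show "(\<lambda>z. cnj (\<psi> w) * repr_kernel \<Omega> \<rho> n (\<phi> w) z) \<in> ?H"
      by (intro hardy_sobolev_scale repr_kernel_in_hardy_sobolev \<phi>w)
  next
    fix F assume F: "F \<in> ?H"
    then have "?W F \<in> ?H"
      using assms(13) by (simp add: bounded_weighted_comp_def)
    then have "hs_inner \<Omega> \<rho> n (?W F) (repr_kernel \<Omega> \<rho> n w) = \<psi> w * F (\<phi> w)"
      using w by (simp add: hs_inner_repr_kernel weighted_comp_def)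
    also have "\<dots> = hs_inner \<Omega> \<rho> n F (\<lambda>z. cnj (\<psi> w) * repr_kernel \<Omega> \<rho> n (\<phi> w) z)"
      using F \<phi>w by (simp add: hs_inner_scale_right repr_kernel_in_hardy_sobolev hs_inner_repr_kernel)
    finally show "hs_inner \<Omega> \<rho> n (?W F) (repr_kernel \<Omega> \<rho> n w) =
        hs_inner \<Omega> \<rho> n F (\<lambda>z. cnj (\<psi> w) * repr_kernel \<Omega> \<rho> n (\<phi> w) z)" .
  qed
qed

end
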